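(* Let $n>1$, let $q\in\Bbbk$ be a primitive $n^2$-th root of unity, $\zeta=q^n$, let $C_n=\langle c\rangle$ be the cyclic group of order $n$, let $0\le w\le n-1$, and consider the dual quasi-bialgebra $(\Bbbk C_n,\omega_{\zeta^w})$. Let $0\le z\le n-1$ and $\chi\in(\Bbbk C_n)^*$. If $((\Bbbk C_n,\omega_{\zeta^w}),c^z,\chi)$ is a quasi-Yetter-Drinfeld datum, then $$\chi(c^t)=\chi(c)^t\ \text{ for } 0\le t\le n-1\quad\text{and}\quad \chi(c)^n=\zeta^{wz}\qquad(\star)$$ (equivalently, $\chi(c^t)=\chi(c)^{t'}$ for all $t\in\mathbb N$ and $\chi(c)^n=\zeta^{wz}$, where $t'\in\{0,\dots,n-1\}$ is congruent to $t$ modulo $n$). Conversely, if $\chi$ is unitary (that is, $\chi(1)=1$) and satisfies $(\star)$ for some $0\le z\le n-1$, then $((\Bbbk C_n,\omega_{\zeta^w}),c^z,\chi)$ is a quasi-Yetter-Drinfeld datum.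
   Context: Conventions: $\Bbbk$ is an algebraically closed field of characteristic zero; everything is over $\Bbbk$. $\Delta(h)=h_1\otimes h_2$ (summation omitted), $\ast$ is convolution, $\omega^{-1}$ is the convolution inverse, $G(H)$ is the set of grouplike elements. A coalgebra with multiplication and unit is a coalgebra $H$ with coalgebra maps $m:H\otimes H\to H$, $u:\Bbbk\to H$; $1_H=u(1)$. A dual quasi-bialgebra $(H,\omega)$ is a coalgebra with multiplication and unit together with a convolution invertible $\omega:H^{\otimes 3}\to\Bbbk$ such that $(\varepsilon\otimes\omega)\ast\omega(\mathrm{id}\otimes m\otimes \mathrm{id})\ast(\omega\otimes\varepsilon)=\omega(\mathrm{id}\otimes \mathrm{id}\otimes m)\ast\omega(m\otimes \mathrm{id}\otimes \mathrm{id})$ (3-cocycle), $\omega(h\otimes 1_H\otimes h')=\varepsilon(h)\varepsilon(h')$ (normalized), $h_1(k_1l_1)\,\omega(h_2\otimes k_2\otimes l_2)=\omega(h_1\otimes k_1\otimes l_1)\,(h_2k_2)l_2$ and $1_Hh=h=h1_H$. Quasi-Yetter-Drinfeld datum $((H,\omega),g,\chi)$: $(H,\omega)$ a dual quasi-bialgebra, $g\in G(H)$, $\chi\in H^*$ with $\chi(1_H)=1$, such that for all $h,l\in H$: $\chi(hl)=\omega^{-1}(h_1\otimes l_1\otimes g)\chi(l_2)\omega(h_2\otimes g\otimes l_3)\chi(h_3)\omega^{-1}(g\otimes h_4\otimes l_4)$ and $g\chi(h_1)h_2=h_1\chi(h_2)g$. For $0\le i\le n-1$, $\omega_{\zeta^i}:(\Bbbk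 C_n)^{\otimes3}\to\Bbbk$ is the normalized 3-cocycle defined for integers $a,b,d\ge0$ by $\omega_{\zeta^i}(c^a\otimes c^b\otimes c^d)=\zeta^{ia[[b'+d'>n-1]]}$, where $b',d'\in\{0,\dots,n-1\}$ are the residues modulo $n$ and $[[P]]$ is $1$ if $P$ holds and $0$ otherwise. $\Bbbk C_n$ has its usual group algebra multiplication, unit and coalgebra structure. *)

theory Defs
  imports
    "HOL-Algebra.Generated_Groups"
    "HOL-Algebra.Multiplicative_Group"
    "HOL-Computational_Algebra.Polynomial"
    "HOL-Library.Multiset"
    "HOL-Library.Poly_Mapping"
begin

text \<open>
  Vector spaces are subspaces \<open>H\<close> of an ambient type \<open>'h\<close> with scalar multiplication \<open>scale\<close>, and
  maps out of \<open>H \<otimes> \<dots> \<otimes> H\<close> are multilinear maps on \<open>H\<close>.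
\<close>

definition linear_form_on ::
    "('k::field \<Rightarrow> 'h::ab_group_add \<Rightarrow> 'h) \<Rightarrow> 'h set \<Rightarrow> ('h \<Rightarrow> 'k) \<Rightarrow> bool"
  where "linear_form_on scale H f \<longleftrightarrow>
    (\<forall>x\<in>H. \<forall>y\<in>H. f (x + y) = f x + f y) \<and> (\<forall>a. \<forall>x\<in>H. f (scale a x) = a * f x)"

definition bilinear_form_on ::
    "('k::field \<Rightarrow> 'h::ab_group_add \<Rightarrow> 'h) \<Rightarrow> 'h set \<Rightarrow> ('h \<Rightarrow> 'h \<Rightarrow> 'k) \<Rightarrow> bool"
  where "bilinear_form_on scale H f \<longleftrightarrow>
    (\<forall>y\<in>H. linear_form_on scale H (\<lambda>x. f x y)) \<and> (\<forall>x\<in>H. linear_form_on scale H (\<lambda>y. f x y))"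

definition trilinear_form_on ::
    "('k::field \<Rightarrow> 'h::ab_group_add \<Rightarrow> 'h) \<Rightarrow> 'h set \<Rightarrow> ('h \<Rightarrow> 'h \<Rightarrow> 'h \<Rightarrow> 'k) \<Rightarrow> bool"
  where "trilinear_form_on scale H f \<longleftrightarrow>
    (\<forall>y\<in>H. \<forall>z\<in>H. linear_form_on scale H (\<lambda>x. f x y z)) \<and>
    (\<forall>x\<in>H. \<forall>z\<in>H. linear_form_on scale H (\<lambda>y. f x y z)) \<and>
    (\<forall>x\<in>H. \<forall>y\<in>H. linear_form_on scale H (\<lambda>z. f x y z))"

definition bilinear_op_on ::
    "('k::field \<Rightarrow> 'h::ab_group_add \<Rightarrow> 'h) \<Rightarrow> 'h set \<Rightarrow> ('h \<Rightarrow> 'h \<Rightarrow> 'h) \<Rightarrow> bool"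
  where "bilinear_op_on scale H m \<longleftrightarrow>
    (\<forall>x\<in>H. \<forall>y\<in>H. m x y \<in> H) \<and>
    (\<forall>x\<in>H. \<forall>y\<in>H. \<forall>z\<in>H. m (x + y) z = m x z + m y z \<and> m z (x + y) = m z x + m z y) \<and>
    (\<forall>a. \<forall>x\<in>H. \<forall>y\<in>H. m (scale a x) y = scale a (m x y) \<and> m x (scale a y) = scale a (m x y))"

text \<open>
  An element of \<open>H \<otimes> H\<close> is given by a finite multiset of pairs, \<open>{#(x\<^sub>1, y\<^sub>1), \<dots>, (x\<^sub>r, y\<^sub>r)#}\<close>
  standing for \<open>x\<^sub>1 \<otimes> y\<^sub>1 + \<dots> + x\<^sub>r \<otimes> y\<^sub>r\<close>; likewise for \<open>H \<otimes> H \<otimes> H\<close>.  Two such sums are equal as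
  tensors iff every multilinear form takes the same value on both, since over a field the linear
  forms separate the points of the tensor product.
\<close>

definition tensor2_eq ::
    "('k::field \<Rightarrow> 'h::ab_group_add \<Rightarrow> 'h) \<Rightarrow> 'h set \<Rightarrow> ('h \<times> 'h) multiset \<Rightarrow> ('h \<times> 'h) multiset \<Rightarrow> bool"
  where "tensor2_eq scale H S T \<longleftrightarrow>
    (\<forall>\<beta>. bilinear_form_on scale H \<beta> \<longrightarrow> (\<Sum>(x, y)\<in>#S. \<beta> x y) = (\<Sum>(x, y)\<in>#T. \<beta> x y))"

definition tensor3_eq ::
    "('k::field \<Rightarrow> 'h::ab_group_add \<Rightarrow> 'h) \<Rightarrow> 'h set \<Rightarrow>
      ('h \<times> 'h \<times> 'h) multiset \<Rightarrow> ('h \<times> 'h \<times> 'h) multiset \<Rightarrow> bool"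
  where "tensor3_eq scale H S T \<longleftrightarrow>
    (\<forall>\<tau>. trilinear_form_on scale H \<tau> \<longrightarrow>
      (\<Sum>(x, y, z)\<in>#S. \<tau> x y z) = (\<Sum>(x, y, z)\<in>#T. \<tau> x y z))"

text \<open>
  With \<open>\<Delta> h\<close> a multiset of pairs, the Sweedler sum \<open>F(h\<^sub>1, h\<^sub>2)\<close> is literally
  \<open>\<Sum>(h1, h2)\<in>#\<Delta> h. F h1 h2\<close>.  The iterated versions expand the leftmost tensor factor.
\<close>

definition sweedler3 :: "('h \<Rightarrow> ('h \<times> 'h) multiset) \<Rightarrow> 'h \<Rightarrow> ('h \<times> 'h \<times> 'h) multiset"
  where "sweedler3 \<Delta> h = (\<Sum>(x, z)\<in>#\<Delta> h. {#(x1, x2, z). (x1, x2) \<in># \<Delta> x#})"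

definition sweedler4 :: "('h \<Rightarrow> ('h \<times> 'h) multiset) \<Rightarrow> 'h \<Rightarrow> ('h \<times> 'h \<times> 'h \<times> 'h) multiset"
  where "sweedler4 \<Delta> h = (\<Sum>(x, y, z)\<in>#sweedler3 \<Delta> h. {#(x1, x2, y, z). (x1, x2) \<in># \<Delta> x#})"

locale coalgebra = vector_space scale
  for scale :: "'k::field \<Rightarrow> 'h::ab_group_add \<Rightarrow> 'h" +
  fixes H :: "'h set"
    and \<Delta> :: "'h \<Rightarrow> ('h \<times> 'h) multiset"
    and \<epsilon> :: "'h \<Rightarrow> 'k"
  assumes subspace_H: "subspace H"
    and \<Delta>_closed: "h \<in> H \<Longrightarrow> set_mset (\<Delta> h) \<subseteq> H \<times> H"
    and \<Delta>_add: "\<lbrakk>h \<in> H; k \<in> H\<rbrakk> \<Longrightarrow> tensor2_eq scale H (\<Delta> (h + k)) (\<Delta> h + \<Delta> k)"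
    and \<Delta>_scale: "h \<in> H \<Longrightarrow>
      tensor2_eq scale H (\<Delta> (scale a h)) {#(scale a h1, h2). (h1, h2) \<in># \<Delta> h#}"
    and \<epsilon>_linear: "linear_form_on scale H \<epsilon>"
    and coassoc: "h \<in> H \<Longrightarrow>
      tensor3_eq scale H (sweedler3 \<Delta> h) (\<Sum>(x, y)\<in>#\<Delta> h. {#(x, y1, y2). (y1, y2) \<in># \<Delta> y#})"
    and counit_left: "h \<in> H \<Longrightarrow> (\<Sum>(h1, h2)\<in>#\<Delta> h. scale (\<epsilon> h1) h2) = h"
    and counit_right: "h \<in> H \<Longrightarrow> (\<Sum>(h1, h2)\<in>#\<Delta> h. scale (\<epsilon> h2) h1) = h"
begin

definition grouplikes :: "'h set"
  where "grouplikes = {g \<in> H. tensor2_eq scale H (\<Delta> g) {#(g, g)#} \<and> \<epsilon> g = 1}"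

end

text \<open>
  The last four assumptions say that the multiplication \<open>H \<otimes> H \<rightarrow> H\<close> and the unit map
  \<open>a \<mapsto> scale a \<one>H\<close> are coalgebra maps.
\<close>

locale coalgebra_with_mult_unit = coalgebra scale H \<Delta> \<epsilon>
  for scale :: "'k::field \<Rightarrow> 'h::ab_group_add \<Rightarrow> 'h" and H \<Delta> \<epsilon> +
  fixes mult :: "'h \<Rightarrow> 'h \<Rightarrow> 'h"  (infixl \<open>\<star>\<close> 70)
    and unit :: 'h  (\<open>\<one>H\<close>)
  assumes mult_bilinear: "bilinear_op_on scale H (\<star>)"
    and unit_closed: "\<one>H \<in> H"
    and \<Delta>_mult: "\<lbrakk>h \<in> H; k \<in> H\<rbrakk> \<Longrightarrow>
      tensor2_eq scale H (\<Delta> (h \<star> k))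
        (\<Sum>(h1, h2)\<in>#\<Delta> h. {#(h1 \<star> k1, h2 \<star> k2). (k1, k2) \<in># \<Delta> k#})"
    and \<epsilon>_mult: "\<lbrakk>h \<in> H; k \<in> H\<rbrakk> \<Longrightarrow> \<epsilon> (h \<star> k) = \<epsilon> h * \<epsilon> k"
    and \<Delta>_unit: "tensor2_eq scale H (\<Delta> \<one>H) {#(\<one>H, \<one>H)#}"
    and \<epsilon>_unit: "\<epsilon> \<one>H = 1"

definition conv3 ::
    "('h \<Rightarrow> ('h \<times> 'h) multiset) \<Rightarrow> ('h \<Rightarrow> 'h \<Rightarrow> 'h \<Rightarrow> 'k::comm_ring_1) \<Rightarrow> ('h \<Rightarrow> 'h \<Rightarrow> 'h \<Rightarrow> 'k) \<Rightarrow>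
      'h \<Rightarrow> 'h \<Rightarrow> 'h \<Rightarrow> 'k"
  where "conv3 \<Delta> f g h k l =
    (\<Sum>(h1, h2)\<in>#\<Delta> h. \<Sum>(k1, k2)\<in>#\<Delta> k. \<Sum>(l1, l2)\<in>#\<Delta> l. f h1 k1 l1 * g h2 k2 l2)"

definition conv4 ::
    "('h \<Rightarrow> ('h \<times> 'h) multiset) \<Rightarrow> ('h \<Rightarrow> 'h \<Rightarrow> 'h \<Rightarrow> 'h \<Rightarrow> 'k::comm_ring_1) \<Rightarrow>
      ('h \<Rightarrow> 'h \<Rightarrow> 'h \<Rightarrow> 'h \<Rightarrow> 'k) \<Rightarrow> 'h \<Rightarrow> 'h \<Rightarrow> 'h \<Rightarrow> 'h \<Rightarrow> 'k"
  where "conv4 \<Delta> f g h k l r =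
    (\<Sum>(h1, h2)\<in>#\<Delta> h. \<Sum>(k1, k2)\<in>#\<Delta> k. \<Sum>(l1, l2)\<in>#\<Delta> l. \<Sum>(r1, r2)\<in>#\<Delta> r.
      f h1 k1 l1 r1 * g h2 k2 l2 r2)"

definition is_conv_inverse ::
    "('k::field \<Rightarrow> 'h::ab_group_add \<Rightarrow> 'h) \<Rightarrow> 'h set \<Rightarrow> ('h \<Rightarrow> ('h \<times> 'h) multiset) \<Rightarrow> ('h \<Rightarrow> 'k) \<Rightarrow>
      ('h \<Rightarrow> 'h \<Rightarrow> 'h \<Rightarrow> 'k) \<Rightarrow> ('h \<Rightarrow> 'h \<Rightarrow> 'h \<Rightarrow> 'k) \<Rightarrow> bool"
  where "is_conv_inverse scale H \<Delta> \<epsilon> \<omega> \<omega>' \<longleftrightarrow> trilinear_form_on scale H \<omega>' \<and>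
    (\<forall>h\<in>H. \<forall>k\<in>H. \<forall>l\<in>H.
      conv3 \<Delta> \<omega> \<omega>' h k l = \<epsilon> h * \<epsilon> k * \<epsilon> l \<and> conv3 \<Delta> \<omega>' \<omega> h k l = \<epsilon> h * \<epsilon> k * \<epsilon> l)"

locale dual_quasi_bialgebra = coalgebra_with_mult_unit scale H \<Delta> \<epsilon> mult unit
  for scale :: "'k::field \<Rightarrow> 'h::ab_group_add \<Rightarrow> 'h" and H \<Delta> \<epsilon>
    and mult (infixl \<open>\<star>\<close> 70) and unit (\<open>\<one>H\<close>) +
  fixes \<omega> :: "'h \<Rightarrow> 'h \<Rightarrow> 'h \<Rightarrow> 'k"
  assumes \<omega>_trilinear: "trilinear_form_on scale H \<omega>"
    and \<omega>_invertible: "\<exists>\<omega>'. is_conv_inverse scale H \<Delta> \<epsilon> \<omega> \<omega>'"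
    and cocycle: "\<lbrakk>h \<in> H; k \<in> H; l \<in> H; r \<in> H\<rbrakk> \<Longrightarrow>
      conv4 \<Delta> (conv4 \<Delta> (\<lambda>h k l r. \<epsilon> h * \<omega> k l r) (\<lambda>h k l r. \<omega> h (k \<star> l) r))
               (\<lambda>h k l r. \<omega> h k l * \<epsilon> r) h k l r
      = conv4 \<Delta> (\<lambda>h k l r. \<omega> h k (l \<star> r)) (\<lambda>h k l r. \<omega> (h \<star> k) l r) h k l r"
    and \<omega>_normalized: "\<lbrakk>h \<in> H; h' \<in> H\<rbrakk> \<Longrightarrow> \<omega> h \<one>H h' = \<epsilon> h * \<epsilon> h'"
    and quasi_assoc: "\<lbrakk>h \<in> H; k \<in> H; l \<in> H\<rbrakk> \<Longrightarrow>
      (\<Sum>(h1, h2)\<in>#\<Delta> h. \<Sum>(k1, k2)\<in>#\<Delta> k. \<Sum>(l1, l2)\<in>#\<Delta> l. scale (\<omega> h2 k2 l2) (h1 \<star> (k1 \<star> l1)))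
      = (\<Sum>(h1, h2)\<in>#\<Delta> h. \<Sum>(k1, k2)\<in>#\<Delta> k. \<Sum>(l1, l2)\<in>#\<Delta> l. scale (\<omega> h1 k1 l1) ((h2 \<star> k2) \<star> l2))"
    and unit_left: "h \<in> H \<Longrightarrow> \<one>H \<star> h = h"
    and unit_right: "h \<in> H \<Longrightarrow> h \<star> \<one>H = h"
begin

text \<open>The convolution inverse is unique as a form on \<open>H\<close>; off \<open>H\<close> its values are irrelevant.\<close>

definition \<omega>_inv :: "'h \<Rightarrow> 'h \<Rightarrow> 'h \<Rightarrow> 'k"
  where "\<omega>_inv = (SOME \<omega>'. is_conv_inverse scale H \<Delta> \<epsilon> \<omega> \<omega>')"

end

locale quasi_YD_datum = dual_quasi_bialgebra scale H \<Delta> \<epsilon> mult unit \<omega>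
  for scale :: "'k::field \<Rightarrow> 'h::ab_group_add \<Rightarrow> 'h" and H \<Delta> \<epsilon>
    and mult (infixl \<open>\<star>\<close> 70) and unit (\<open>\<one>H\<close>) and \<omega> +
  fixes g :: 'h
    and \<chi> :: "'h \<Rightarrow> 'k"
  assumes g_grouplike: "g \<in> grouplikes"
    and \<chi>_linear: "linear_form_on scale H \<chi>"
    and \<chi>_unit: "\<chi> \<one>H = 1"
    and \<chi>_mult: "\<lbrakk>h \<in> H; l \<in> H\<rbrakk> \<Longrightarrow>
      \<chi> (h \<star> l) = (\<Sum>(h1, h2, h3, h4)\<in>#sweedler4 \<Delta> h. \<Sum>(l1, l2, l3, l4)\<in>#sweedler4 \<Delta> l.
        \<omega>_inv h1 l1 g * \<chi> l2 * \<omega> h2 g l3 * \<chi> h3 * \<omega>_inv g h4 l4)"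
    and g_\<chi>_commute: "h \<in> H \<Longrightarrow>
      (\<Sum>(h1, h2)\<in>#\<Delta> h. scale (\<chi> h1) (g \<star> h2)) = (\<Sum>(h1, h2)\<in>#\<Delta> h. scale (\<chi> h2) (h1 \<star> g))"

text \<open>
  The group algebra of \<open>G\<close>: finitely supported functions on \<open>carrier G\<close>, the group element \<open>x\<close>
  being \<open>ga_elem x\<close>.
\<close>

definition ga_scale :: "'k::field \<Rightarrow> ('g \<Rightarrow>\<^sub>0 'k) \<Rightarrow> ('g \<Rightarrow>\<^sub>0 'k)"
  where "ga_scale a f = Poly_Mapping.map ((*) a) f"

definition ga_space :: "('g, 'm) monoid_scheme \<Rightarrow> ('g \<Rightarrow>\<^sub>0 'k::field) set"
  where "ga_space G = {f. Poly_Mapping.keys f \<subseteq> carrier G}"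

definition ga_elem :: "'g \<Rightarrow> ('g \<Rightarrow>\<^sub>0 'k::field)"
  where "ga_elem x = Poly_Mapping.single x 1"

definition ga_comult :: "('g \<Rightarrow>\<^sub>0 'k::field) \<Rightarrow> (('g \<Rightarrow>\<^sub>0 'k) \<times> ('g \<Rightarrow>\<^sub>0 'k)) multiset"
  where "ga_comult f =
    {#(ga_scale (Poly_Mapping.lookup f x) (ga_elem x), ga_elem x).
      x \<in># mset_set (Poly_Mapping.keys f)#}"

definition ga_counit :: "('g \<Rightarrow>\<^sub>0 'k::field) \<Rightarrow> 'k"
  where "ga_counit f = (\<Sum>x\<in>Poly_Mapping.keys f. Poly_Mapping.lookup f x)"

definition ga_mult ::
    "('g, 'm) monoid_scheme \<Rightarrow> ('g \<Rightarrow>\<^sub>0 'k::field) \<Rightarrow> ('g \<Rightarrow>\<^sub>0 'k) \<Rightarrow> ('g \<Rightarrow>\<^sub>0 'k)"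
  where "ga_mult G f f' = (\<Sum>x\<in>Poly_Mapping.keys f. \<Sum>y\<in>Poly_Mapping.keys f'.
    ga_scale (Poly_Mapping.lookup f x * Poly_Mapping.lookup f' y) (ga_elem (x \<otimes>\<^bsub>G\<^esub> y)))"

definition ga_unit :: "('g, 'm) monoid_scheme \<Rightarrow> ('g \<Rightarrow>\<^sub>0 'k::field)"
  where "ga_unit G = ga_elem \<one>\<^bsub>G\<^esub>"

text \<open>The residue \<open>a' \<in> {0, \<dots>, n - 1}\<close> with \<open>x = c\<^sup>a'\<close>, for \<open>x\<close> in the cyclic group \<open>\<langle>c\<rangle>\<close> of order \<open>n\<close>.\<close>

definition cyc_exp :: "('g, 'm) monoid_scheme \<Rightarrow> 'g \<Rightarrow> 'g \<Rightarrow> nat"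
  where "cyc_exp G c x = (LEAST a. x = c [^]\<^bsub>G\<^esub> a)"

text \<open>
  The trilinear form \<open>\<omega>\<^sub>\<xi>\<close> with \<open>\<omega>\<^sub>\<xi>(c\<^sup>a \<otimes> c\<^sup>b \<otimes> c\<^sup>d) = \<xi>\<^sup>a\<close> if \<open>b' + d' > n - 1\<close> and \<open>1\<close> otherwise, for an
  \<open>n\<close>-th root of unity \<open>\<xi>\<close>; as \<open>\<xi>\<^sup>n = 1\<close>, the exponent \<open>a\<close> only matters modulo \<open>n\<close>
  (see \<open>cyc_omega_pow\<close> below).
\<close>

definition cyc_omega ::
    "('g, 'm) monoid_scheme \<Rightarrow> 'g \<Rightarrow> 'k::field \<Rightarrow> ('g \<Rightarrow>\<^sub>0 'k) \<Rightarrow> ('g \<Rightarrow>\<^sub>0 'k) \<Rightarrow> ('g \<Rightarrow>\<^sub>0 'k) \<Rightarrow> 'k"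
  where "cyc_omega G c \<xi> f f' f'' =
    (\<Sum>x\<in>Poly_Mapping.keys f. \<Sum>y\<in>Poly_Mapping.keys f'. \<Sum>z\<in>Poly_Mapping.keys f''.
      Poly_Mapping.lookup f x * Poly_Mapping.lookup f' y * Poly_Mapping.lookup f'' z *
      \<xi> ^ (cyc_exp G c x *
            of_bool (cyc_exp G c y + cyc_exp G c z > card (carrier G) - 1)))"

lemma (in group) pow_mod_card:
  assumes "c \<in> carrier G" "finite (carrier G)"
  shows "c [^] (a mod card (carrier G)) = c [^] (a::nat)"
proof -
  have "c [^] card (carrier G) = \<one>"
    using pow_order_eq_1[OF assms(1)] by (simp add: Coset.order_def)
  then have *: "c [^] (card (carrier G) * (a div card (carrier G))) = \<one>"
    using assms by (simp flip: nat_pow_pow)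
  have "c [^] a = c [^] (card (carrier G) * (a div card (carrier G)) + a mod card (carrier G))"
    by simp
  also have "\<dots> = c [^] (a mod card (carrier G))"
    using assms(1) * by (simp only: nat_pow_mult [symmetric] l_one nat_pow_closed)
  finally show ?thesis by simp
qed

lemma (in group) cyc_exp_pow:
  assumes c: "c \<in> carrier G" "carrier G = generate G {c}" and fin: "finite (carrier G)"
  shows "cyc_exp G c (c [^] (a::nat)) = a mod card (carrier G)"
proof -
  let ?n = "card (carrier G)"
  have n: "?n > 0" using fin c by (auto simp: card_gt_0_iff)
  have "carrier G \<subseteq> (\<lambda>k::nat. c [^] k) ` {..<?n}"
  proof
    fix x assume "x \<in> carrier G"
    then obtain k :: int where "x = c [^] k"
      using c generate_pow[OF c(1)] by auto
    also have "c [^] k = c [^] (nat (k mod int ?n))"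
    proof -
      have "c [^] (int ?n * (k div int ?n) + k mod int ?n) =
          (c [^] int ?n) [^] (k div int ?n) \<otimes> c [^] (k mod int ?n)"
        using c(1) by (simp only: int_pow_mult int_pow_pow)
      also have "c [^] int ?n = \<one>"
        using pow_order_eq_1[OF c(1)] by (simp add: int_pow_int Coset.order_def)
      finally have "c [^] k = c [^] (k mod int ?n)" using c(1) by simp
      also have "\<dots> = c [^] int (nat (k mod int ?n))" using n by simp
      finally show ?thesis by (simp only: int_pow_int)
    qed
    finally show "x \<in> (\<lambda>k::nat. c [^] k) ` {..<?n}"
      using n by (auto intro!: image_eqI[where x = "nat (k mod int ?n)"] simp: nat_less_iff)
  qed
  then have "carrier G = (\<lambda>k::nat. c [^] k) ` {..<?n}" using c(1) by auto
  then have inj: "inj_on (\<lambda>k::nat. c [^] k) {..<?n}"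
    by (intro eq_card_imp_inj_on) auto
  show ?thesis unfolding cyc_exp_def
  proof (rule Least_equality)
    show "c [^] a = c [^] (a mod ?n)" using pow_mod_card[OF c(1) fin] by simp
  next
    fix y :: nat assume "c [^] a = c [^] y"
    then have "c [^] (a mod ?n) = c [^] (y mod ?n)" using pow_mod_card[OF c(1) fin] by simp
    then have "a mod ?n = y mod ?n" using inj n by (auto dest: inj_onD)
    then show "a mod ?n \<le> y" by simp
  qed
qed

lemma (in group) cyc_omega_pow:
  fixes \<xi> :: "'k::field" and a b d :: nat
  assumes "c \<in> carrier G" "carrier G = generate G {c}" "finite (carrier G)"
    and "card (carrier G) = n" "\<xi> ^ n = 1"
  shows "cyc_omega G c \<xi> (ga_elem (c [^] a)) (ga_elem (c [^] b)) (ga_elem (c [^] d)) =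
    \<xi> ^ (a * of_bool (b mod n + d mod n > n - 1))"
proof -
  have "\<xi> ^ (a mod n) = \<xi> ^ (n * (a div n)) * \<xi> ^ (a mod n)"
    using assms(5) by (simp add: power_mult)
  also have "\<dots> = \<xi> ^ a" by (simp flip: power_add)
  finally show ?thesis using assms
    by (simp add: cyc_omega_def ga_elem_def cyc_exp_pow)
qed

definition primitive_root_of_unity :: "nat \<Rightarrow> 'k::field \<Rightarrow> bool"
  where "primitive_root_of_unity m q \<longleftrightarrow> m > 0 \<and> q ^ m = 1 \<and> (\<forall>j. 0 < j \<and> j < m \<longrightarrow> q ^ j \<noteq> 1)"

end

theory Submission
  imports Defs
begin

text \<open>
  All structure maps of a group algebra are determined by their values on the basis of group
  elements, and there every Sweedler sum collapses, because \<open>\<Delta> x = x \<otimes> x\<close>: convolution becomes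
  pointwise multiplication of functions on the group, so \<open>\<omega>\<close> is a trilinear extension of a
  normalized, nowhere vanishing group 3-cocycle \<open>\<phi>\<close>, and \<open>\<omega>\<close> has the extension of \<open>1 / \<phi>\<close> as its
  convolution inverse (\<open>is_conv_inverse_ga_form3\<close>).  Hence the conditions on a quasi-Yetter-Drinfeld
  datum reduce, for every monoid and every such \<open>\<phi>\<close>, to conditions on group elements
  (\<open>quasi_YD_datum_iff\<close>): \<open>\<chi> 1 = 1\<close>, the element \<open>g\<close> commutes with the \<open>x\<close> for which \<open>\<chi> x \<noteq> 0\<close>, and
  \<open>\<chi> (xy) = \<phi>(x, y, g)\<^sup>-\<^sup>1 \<phi>(x, g, y) \<phi>(g, x, y)\<^sup>-\<^sup>1 \<chi>(x) \<chi>(y)\<close>.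

  For the cyclic group of order \<open>n\<close> and an \<open>n\<close>-th root of unity \<open>\<xi>\<close> the cocycle is
  \<open>\<phi>(c\<^sup>a, c\<^sup>b, c\<^sup>d) = \<xi>\<^sup>a\<close> to the power of the carry of \<open>b + d\<close> in base \<open>n\<close>.  The cocycle identity says
  that both ways of adding three digits produce the same total carry (\<open>carry_cocycle\<close>).  As
  \<open>\<phi>\<close> is symmetric in its last two arguments, the first two factors above cancel; as the group is
  abelian, \<open>g\<close> commutes with everything.  What remains for \<open>g = c\<^sup>z\<close> is
  \<open>\<chi>(c\<^sup>a\<^sup>+\<^sup>b) \<xi>\<^sup>z = \<chi>(c\<^sup>a) \<chi>(c\<^sup>b)\<close> if \<open>a + b \<ge> n\<close>, and \<open>\<chi>(c\<^sup>a\<^sup>+\<^sup>b) = \<chi>(c\<^sup>a) \<chi>(c\<^sup>b)\<close> otherwise, for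
  \<open>0 \<le> a, b < n\<close> (\<open>quasi_YD_datum_cyc_omega_iff\<close>).  Adding \<open>1\<close> repeatedly, with no carry until
  the exponent reaches \<open>n\<close>, gives \<open>\<chi>(c\<^sup>t) = \<chi>(c)\<^sup>t\<close> for \<open>t < n\<close>; the last step, from \<open>n - 1\<close>
  to \<open>n\<close>, carries and gives \<open>\<chi>(c)\<^sup>n = \<xi>\<^sup>z\<close>.  Conversely these values satisfy the relation for all
  \<open>a\<close> and \<open>b\<close>.  The theorem is the case \<open>\<xi> = \<zeta>\<^sup>w\<close>.
\<close>

section \<open>Finitely supported functions and linear forms\<close>

abbreviation ga_basis :: "'g \<Rightarrow> ('g \<Rightarrow>\<^sub>0 'k::field)"
  where "ga_basis x \<equiv> Poly_Mapping.single x 1"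

lemma lookup_ga_scale [simp]: "Poly_Mapping.lookup (ga_scale a f) x = a * Poly_Mapping.lookup f x"
  by (auto simp: ga_scale_def Poly_Mapping.map.rep_eq when_def)

lemma ga_scale_single [simp]: "ga_scale a (Poly_Mapping.single x b) = Poly_Mapping.single x (a * b)"
  by (intro poly_mapping_eqI) (simp add: lookup_single when_def)

lemma ga_scale_zero: "ga_scale a 0 = 0"
  by (intro poly_mapping_eqI) simp

lemma vector_space_ga_scale: "vector_space (ga_scale :: 'k::field \<Rightarrow> ('g \<Rightarrow>\<^sub>0 'k) \<Rightarrow> _)"
  by unfold_locales (auto intro!: poly_mapping_eqI simp: lookup_add algebra_simps)

lemma subspace_ga_space: "module.subspace ga_scale (ga_space G :: ('g \<Rightarrow>\<^sub>0 'k::field) set)"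
proof -
  interpret vector_space "ga_scale :: 'k \<Rightarrow> ('g \<Rightarrow>\<^sub>0 'k) \<Rightarrow> _" by (rule vector_space_ga_scale)
  show ?thesis
    by (rule subspaceI) (auto simp: ga_space_def in_keys_iff lookup_add subset_iff, metis add_cancel_right_left)
qed

lemma single_in_ga_space [simp]: "x \<in> carrier G \<Longrightarrow> Poly_Mapping.single x a \<in> ga_space G"
  by (simp add: ga_space_def)

lemma ga_space_keysD: "\<lbrakk>f \<in> ga_space G; x \<in> Poly_Mapping.keys f\<rbrakk> \<Longrightarrow> x \<in> carrier G"
  by (auto simp: ga_space_def)

lemma ga_expansion: "f = (\<Sum>x\<in>Poly_Mapping.keys f. Poly_Mapping.single x (Poly_Mapping.lookup f x))"
  by (intro poly_mapping_eqI)
    (auto simp: lookup_sum lookup_single when_def in_keys_iff)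

text \<open>
  The support of \<open>f + g\<close> can be smaller than the union of the supports, so sums over supports are
  compared on that union, where the extra terms are \<open>F x 0 = 0\<close>.
\<close>

lemma sum_keys_add:
  fixes F :: "'g \<Rightarrow> 'k::monoid_add \<Rightarrow> 'b::comm_monoid_add"
  assumes "\<And>x. x \<in> Poly_Mapping.keys f \<union> Poly_Mapping.keys g \<Longrightarrow> F x 0 = 0"
    and "\<And>x a b. x \<in> Poly_Mapping.keys f \<union> Poly_Mapping.keys g \<Longrightarrow> F x (a + b) = F x a + F x b"
  shows "(\<Sum>x\<in>Poly_Mapping.keys (f + g). F x (Poly_Mapping.lookup (f + g) x)) =
    (\<Sum>x\<in>Poly_Mapping.keys f. F x (Poly_Mapping.lookup f x)) +
    (\<Sum>x\<in>Poly_Mapping.keys g. F x (Poly_Mapping.lookup g x))"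
proof -
  let ?K = "Poly_Mapping.keys f \<union> Poly_Mapping.keys g"
  have ext: "(\<Sum>x\<in>Poly_Mapping.keys h. F x (Poly_Mapping.lookup h x)) =
      (\<Sum>x\<in>?K. F x (Poly_Mapping.lookup h x))" if "Poly_Mapping.keys h \<subseteq> ?K" for h
    using that assms(1) by (intro sum.mono_neutral_left) (auto simp: in_keys_iff)
  show ?thesis
    unfolding ext[OF Poly_Mapping.keys_add] ext[OF Un_upper1] ext[OF Un_upper2]
    by (simp add: lookup_add assms(2) sum.distrib flip: Un_iff cong: sum.cong_simp)
qed

lemma sum_keys_scale:
  fixes F :: "'g \<Rightarrow> 'k::field \<Rightarrow> 'b::comm_monoid_add"
  assumes "\<And>x. x \<in> Poly_Mapping.keys f \<Longrightarrow> F x 0 = 0"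
  shows "(\<Sum>x\<in>Poly_Mapping.keys (ga_scale a f). F x (Poly_Mapping.lookup (ga_scale a f) x)) =
    (\<Sum>x\<in>Poly_Mapping.keys f. F x (a * Poly_Mapping.lookup f x))"
proof (cases "a = 0")
  case True
  then have "ga_scale a f = 0" by (intro poly_mapping_eqI) simp
  then show ?thesis using True assms by simp
next
  case False
  then have "Poly_Mapping.keys (ga_scale a f) = Poly_Mapping.keys f"
    by (auto simp: in_keys_iff)
  then show ?thesis by simp
qed

lemma ga_space_add: "\<lbrakk>f \<in> ga_space G; g \<in> ga_space G\<rbrakk> \<Longrightarrow> f + g \<in> ga_space G"
  using Poly_Mapping.keys_add[of f g] by (auto simp: ga_space_def)

lemma linear_form_on_sum:
  assumes "linear_form_on ga_scale (ga_space G) F" "\<And>i. i \<in> A \<Longrightarrow> u i \<in> ga_space G"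
  shows "F (\<Sum>i\<in>A. u i) = (\<Sum>i\<in>A. F (u i))"
proof -
  have F0: "F 0 = 0"
    using assms(1)[unfolded linear_form_on_def, THEN conjunct2, rule_format, of 0 0]
    by (simp add: ga_space_def ga_scale_zero)
  \<comment> \<open>Additivity is available on the subspace only, so membership is carried through the induction.\<close>
  have "(\<Sum>i\<in>A. u i) \<in> ga_space G \<and> F (\<Sum>i\<in>A. u i) = (\<Sum>i\<in>A. F (u i))"
    using assms(2)
  proof (induction A rule: infinite_finite_induct)
    case (insert i A)
    then show ?case
      using assms(1) by (auto simp: linear_form_on_def intro: ga_space_add)
  qed (auto simp: F0 ga_space_def)
  then show ?thesis by simp
qed

lemma linear_form_on_single:
  assumes "linear_form_on ga_scale (ga_space G) F" "x \<in> carrier G"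
  shows "F (Poly_Mapping.single x a) = a * F (ga_basis x)"
  using assms(1)[unfolded linear_form_on_def, THEN conjunct2, rule_format, of "ga_basis x" a] assms(2)
  by simp

lemma linear_form_on_linear_extension:
  "linear_form_on ga_scale V (\<lambda>f. \<Sum>x\<in>Poly_Mapping.keys f. Poly_Mapping.lookup f x * \<phi> x)"
  unfolding linear_form_on_def
  using sum_keys_add[where F = "\<lambda>x a. a * \<phi> x"] sum_keys_scale[where F = "\<lambda>x a. a * \<phi> x"]
  by (simp add: distrib_right sum_distrib_left mult.assoc)

section \<open>Sweedler sums\<close>

lemma sum_ga_comult:
  "(\<Sum>p\<in>#ga_comult f. F p) =
    (\<Sum>x\<in>Poly_Mapping.keys f. F (Poly_Mapping.single x (Poly_Mapping.lookup f x), ga_basis x))"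
  by (simp add: ga_comult_def ga_elem_def sum_unfold_sum_mset image_mset.compositionality o_def)

lemma sum_mset_of_sum:
  fixes M :: "'i \<Rightarrow> 'p multiset"
  shows "(\<Sum>p\<in>#(\<Sum>i\<in>A. M i). F p) = (\<Sum>i\<in>A. \<Sum>p\<in>#M i. F p)"
  by (induction A rule: infinite_finite_induct) auto

lemma ga_comult_single:
  "ga_comult (Poly_Mapping.single x a) =
    (if a = 0 then {#} else {#(Poly_Mapping.single x a, ga_basis x)#})"
  by (simp add: ga_comult_def ga_elem_def)

text \<open>
  Iterating the comultiplication never branches: on the support of \<open>f\<close> the coefficient is nonzero, so
  each first factor is again a single term with a one-element comultiplication.
\<close>

lemma sum_sweedler3:
  "(\<Sum>p\<in>#sweedler3 ga_comult f. F p) = (\<Sum>x\<in>Poly_Mapping.keys f.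
    F (Poly_Mapping.single x (Poly_Mapping.lookup f x), ga_basis x, ga_basis x))"
  by (simp add: sweedler3_def sum_ga_comult sum_mset_of_sum ga_comult_single in_keys_iff cong: sum.cong_simp)

lemma sum_sweedler4:
  "(\<Sum>p\<in>#sweedler4 ga_comult f. F p) = (\<Sum>x\<in>Poly_Mapping.keys f.
    F (Poly_Mapping.single x (Poly_Mapping.lookup f x), ga_basis x, ga_basis x, ga_basis x))"
  by (simp add: sweedler4_def sum_sweedler3 sum_mset_of_sum ga_comult_single in_keys_iff cong: sum.cong_simp)

section \<open>The group algebra\<close>

lemma ga_counit_single [simp]: "ga_counit (Poly_Mapping.single x a) = a"
  by (simp add: ga_counit_def)

lemma ga_mult_single [simp]:
  "ga_mult G (Poly_Mapping.single x a) (Poly_Mapping.single y b) = Poly_Mapping.single (x \<otimes>\<^bsub>G\<^esub> y) (a * b)"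
  by (simp add: ga_mult_def ga_elem_def)

lemma bilinear_form_on_single:
  assumes "bilinear_form_on ga_scale (ga_space G) \<beta>" "x \<in> carrier G" "y \<in> carrier G"
  shows "\<beta> (Poly_Mapping.single x a) (ga_basis y) = a * \<beta> (ga_basis x) (ga_basis y)"
  using assms by (auto simp: bilinear_form_on_def intro: linear_form_on_single[where F = "\<lambda>f. \<beta> f (ga_basis y)"])

lemma sum_ga_comult_bilinear:
  assumes \<beta>: "bilinear_form_on ga_scale (ga_space G) \<beta>" and f: "f \<in> ga_space G"
  shows "(\<Sum>(x, y)\<in>#ga_comult f. \<beta> x y) =
    (\<Sum>x\<in>Poly_Mapping.keys f. Poly_Mapping.lookup f x * \<beta> (ga_basis x) (ga_basis x))"
  unfolding sum_ga_comult split
  by (intro sum.cong refl bilinear_form_on_single[OF \<beta>] ga_space_keysD[OF f])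

lemma coalgebra_group_algebra:
  "coalgebra ga_scale (ga_space G :: ('g \<Rightarrow>\<^sub>0 'k::field) set) ga_comult ga_counit"
proof -
  interpret vector_space "ga_scale :: 'k \<Rightarrow> ('g \<Rightarrow>\<^sub>0 'k) \<Rightarrow> _" by (rule vector_space_ga_scale)
  let ?lin = "linear_form_on ga_scale (ga_space G) :: (('g \<Rightarrow>\<^sub>0 'k) \<Rightarrow> 'k) \<Rightarrow> bool"
  have add_in: "h + k \<in> ga_space G" if "h \<in> ga_space G" "k \<in> ga_space G" for h k :: "'g \<Rightarrow>\<^sub>0 'k"
    using that by (rule subspace_add[OF subspace_ga_space])
  have scale_in: "ga_scale a h \<in> ga_space G" if "h \<in> ga_space G" for a and h :: "'g \<Rightarrow>\<^sub>0 'k"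
    using that by (rule subspace_scale[OF subspace_ga_space])
  note lin = linear_form_on_linear_extension[where V = UNIV, unfolded linear_form_on_def, simplified]
  show ?thesis
  proof
    show "subspace (ga_space G :: ('g \<Rightarrow>\<^sub>0 'k) set)" by (rule subspace_ga_space)
  next
    fix h :: "'g \<Rightarrow>\<^sub>0 'k" assume "h \<in> ga_space G"
    then show "set_mset (ga_comult h) \<subseteq> ga_space G \<times> ga_space G"
      by (auto simp: ga_comult_def ga_elem_def ga_space_keysD)
  next
    fix h k :: "'g \<Rightarrow>\<^sub>0 'k" assume "h \<in> ga_space G" "k \<in> ga_space G"
    then show "tensor2_eq ga_scale (ga_space G) (ga_comult (h + k)) (ga_comult h + ga_comult k)"
      by (simp add: tensor2_eq_def sum_ga_comult_bilinear add_in lin)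
  next
    fix h :: "'g \<Rightarrow>\<^sub>0 'k" and a assume h: "h \<in> ga_space G"
    show "tensor2_eq ga_scale (ga_space G) (ga_comult (ga_scale a h))
        {#(ga_scale a h1, h2). (h1, h2) \<in># ga_comult h#}"
      unfolding tensor2_eq_def
    proof (intro allI impI)
      fix \<beta> :: "('g \<Rightarrow>\<^sub>0 'k) \<Rightarrow> ('g \<Rightarrow>\<^sub>0 'k) \<Rightarrow> 'k"
      assume \<beta>: "bilinear_form_on ga_scale (ga_space G) \<beta>"
      have "(\<Sum>(x, y)\<in>#ga_comult (ga_scale a h). \<beta> x y) =
          (\<Sum>x\<in>Poly_Mapping.keys h. a * Poly_Mapping.lookup h x * \<beta> (ga_basis x) (ga_basis x))"
        unfolding sum_ga_comult_bilinear[OF \<beta> scale_in[OF h]] by (rule sum_keys_scale) simp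
      also have "\<dots> = (\<Sum>x\<in>Poly_Mapping.keys h. \<beta> (Poly_Mapping.single x (a * Poly_Mapping.lookup h x)) (ga_basis x))"
        by (intro sum.cong refl bilinear_form_on_single[OF \<beta>, symmetric] ga_space_keysD[OF h])
      finally show "(\<Sum>(x, y)\<in>#ga_comult (ga_scale a h). \<beta> x y) =
          (\<Sum>(x, y)\<in>#{#(ga_scale a h1, h2). (h1, h2) \<in># ga_comult h#}. \<beta> x y)"
        by (simp add: image_mset.compositionality o_def case_prod_unfold sum_ga_comult)
    qed
  next
    show "?lin ga_counit"
      using linear_form_on_linear_extension[where \<phi> = "\<lambda>_. 1"] by (simp add: ga_counit_def[abs_def])
  next
    fix h :: "'g \<Rightarrow>\<^sub>0 'k" assume "h \<in> ga_space G"
    then show "tensor3_eq ga_scale (ga_space G) (sweedler3 ga_comult h)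
      (\<Sum>(x, y)\<in>#ga_comult h. {#(x, y1, y2). (y1, y2) \<in># ga_comult y#})"
      by (simp add: tensor3_eq_def sum_sweedler3 sum_ga_comult sum_mset_of_sum ga_comult_single)
  next
    fix h :: "'g \<Rightarrow>\<^sub>0 'k" assume "h \<in> ga_space G"
    show "(\<Sum>(h1, h2)\<in>#ga_comult h. ga_scale (ga_counit h1) h2) = h"
      and "(\<Sum>(h1, h2)\<in>#ga_comult h. ga_scale (ga_counit h2) h1) = h"
      unfolding sum_ga_comult split ga_counit_single ga_scale_single mult_1_left mult_1_right
      by (rule ga_expansion[symmetric])+
  qed
qed

lemma ga_mult_expand:
  "ga_mult G f f' = (\<Sum>x\<in>Poly_Mapping.keys f. \<Sum>y\<in>Poly_Mapping.keys f'.
    Poly_Mapping.single (x \<otimes>\<^bsub>G\<^esub> y) (Poly_Mapping.lookup f x * Poly_Mapping.lookup f' y))"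
  by (simp add: ga_mult_def ga_elem_def)

lemma ga_mult_bilinear:
  assumes "monoid G"
  shows "bilinear_op_on ga_scale (ga_space G :: ('g \<Rightarrow>\<^sub>0 'k::field) set) (ga_mult G)"
proof -
  interpret monoid G by fact
  interpret vector_space "ga_scale :: 'k \<Rightarrow> ('g \<Rightarrow>\<^sub>0 'k) \<Rightarrow> _" by (rule vector_space_ga_scale)
  have left: "ga_mult G (f + g) h = ga_mult G f h + ga_mult G g h" for f g h :: "'g \<Rightarrow>\<^sub>0 'k"
    unfolding ga_mult_expand
    by (rule sum_keys_add) (simp_all add: distrib_right single_add sum.distrib)
  have swap: "ga_mult G h f = (\<Sum>y\<in>Poly_Mapping.keys f. \<Sum>x\<in>Poly_Mapping.keys h.
    Poly_Mapping.single (x \<otimes>\<^bsub>G\<^esub> y) (Poly_Mapping.lookup h x * Poly_Mapping.lookup f y))"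
    for f h :: "'g \<Rightarrow>\<^sub>0 'k"
    unfolding ga_mult_expand by (rule sum.swap)
  have right: "ga_mult G h (f + g) = ga_mult G h f + ga_mult G h g" for f g h :: "'g \<Rightarrow>\<^sub>0 'k"
    unfolding swap
    by (rule sum_keys_add) (simp_all add: distrib_left single_add sum.distrib)
  have left_scale: "ga_mult G (ga_scale a f) h = ga_scale a (ga_mult G f h)" for a and f h :: "'g \<Rightarrow>\<^sub>0 'k"
    unfolding ga_mult_expand
    by (subst sum_keys_scale) (simp_all add: scale_sum_right mult.assoc)
  have right_scale: "ga_mult G h (ga_scale a f) = ga_scale a (ga_mult G h f)" for a and f h :: "'g \<Rightarrow>\<^sub>0 'k"
    unfolding swap
    by (subst sum_keys_scale) (simp_all add: scale_sum_right mult_ac)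
  show ?thesis
    unfolding bilinear_op_on_def
    by (auto simp: left right left_scale right_scale)
      (auto simp: ga_mult_expand ga_space_keysD intro!: subspace_sum[OF subspace_ga_space])
qed

text \<open>
  This reduces multiplicativity statements about the counit, the comultiplication and \<open>\<chi>\<close> to group
  elements.
\<close>

lemma linear_form_on_ga_mult:
  assumes "monoid G" and F: "linear_form_on ga_scale (ga_space G) F"
    and "h \<in> ga_space G" "k \<in> ga_space G"
  shows "F (ga_mult G h k) = (\<Sum>x\<in>Poly_Mapping.keys h. \<Sum>y\<in>Poly_Mapping.keys k.
    F (Poly_Mapping.single (x \<otimes>\<^bsub>G\<^esub> y) (Poly_Mapping.lookup h x * Poly_Mapping.lookup k y)))"
proof -
  interpret monoid G by fact
  have "F (ga_mult G h k) = (\<Sum>(x, y)\<in>Poly_Mapping.keys h \<times> Poly_Mapping.keys k.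
    F (Poly_Mapping.single (x \<otimes>\<^bsub>G\<^esub> y) (Poly_Mapping.lookup h x * Poly_Mapping.lookup k y)))"
    unfolding ga_mult_expand sum.cartesian_product using assms(3,4)
    by (subst linear_form_on_sum[OF F]) (auto simp: ga_space_keysD intro!: sum.cong)
  then show ?thesis by (simp add: sum.cartesian_product)
qed

lemma coalgebra_with_mult_unit_group_algebra:
  assumes "monoid G"
  shows "coalgebra_with_mult_unit ga_scale (ga_space G :: ('g \<Rightarrow>\<^sub>0 'k::field) set) ga_comult ga_counit
    (ga_mult G) (ga_unit G)"
proof -
  interpret monoid G by fact
  interpret coalgebra ga_scale "ga_space G :: ('g \<Rightarrow>\<^sub>0 'k) set" ga_comult ga_counit
    by (rule coalgebra_group_algebra)
  have mult_closed: "ga_mult G h k \<in> ga_space G" if "h \<in> ga_space G" "k \<in> ga_space G" for h k :: "'g \<Rightarrow>\<^sub>0 'k"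
    using ga_mult_bilinear[OF assms] that unfolding bilinear_op_on_def by blast
  show ?thesis
  proof
    show "bilinear_op_on ga_scale (ga_space G :: ('g \<Rightarrow>\<^sub>0 'k) set) (ga_mult G)"
      using assms by (rule ga_mult_bilinear)
    show "ga_unit G \<in> ga_space G" by (simp add: ga_unit_def ga_elem_def)
    show "tensor2_eq ga_scale (ga_space G) (ga_comult (ga_unit G)) {#(ga_unit G, ga_unit G :: 'g \<Rightarrow>\<^sub>0 'k)#}"
      by (simp add: tensor2_eq_def ga_unit_def ga_elem_def ga_comult_single)
    show "ga_counit (ga_unit G :: 'g \<Rightarrow>\<^sub>0 'k) = 1"
      by (simp add: ga_unit_def ga_elem_def)
  next
    fix h k :: "'g \<Rightarrow>\<^sub>0 'k" assume hk: "h \<in> ga_space G" "k \<in> ga_space G"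
    note lin_mult = linear_form_on_ga_mult[OF assms _ hk]
    show "ga_counit (ga_mult G h k) = ga_counit h * ga_counit k"
      by (subst lin_mult[OF \<epsilon>_linear]) (simp add: ga_counit_def[of h] ga_counit_def[of k] sum_product)
    show "tensor2_eq ga_scale (ga_space G) (ga_comult (ga_mult G h k))
        (\<Sum>(h1, h2)\<in>#ga_comult h. {#(ga_mult G h1 k1, ga_mult G h2 k2). (k1, k2) \<in># ga_comult k#})"
      unfolding tensor2_eq_def
    proof safe
      fix \<beta> :: "('g \<Rightarrow>\<^sub>0 'k) \<Rightarrow> ('g \<Rightarrow>\<^sub>0 'k) \<Rightarrow> 'k"
      assume \<beta>: "bilinear_form_on ga_scale (ga_space G) \<beta>"
      \<comment> \<open>After pairing with \<open>\<beta>\<close>, the comultiplication is a linear form, which can be expanded along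
        the product.\<close>
      define B where "B = (\<lambda>f. \<Sum>x\<in>Poly_Mapping.keys f. Poly_Mapping.lookup f x * \<beta> (ga_basis x) (ga_basis x))"
      have B: "linear_form_on ga_scale (ga_space G) B"
        unfolding B_def by (rule linear_form_on_linear_extension)
      have B_comult: "(\<Sum>(x, y)\<in>#ga_comult f. \<beta> x y) = B f" if "f \<in> ga_space G" for f
        unfolding B_def using \<beta> that by (rule sum_ga_comult_bilinear)
      have "B (ga_mult G h k) = (\<Sum>x\<in>Poly_Mapping.keys h. \<Sum>y\<in>Poly_Mapping.keys k.
          \<beta> (Poly_Mapping.single (x \<otimes>\<^bsub>G\<^esub> y) (Poly_Mapping.lookup h x * Poly_Mapping.lookup k y))
            (ga_basis (x \<otimes>\<^bsub>G\<^esub> y)))"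
        unfolding lin_mult[OF B]
        using hk by (intro sum.cong refl)
          (simp add: B_comult[symmetric] ga_comult_single in_keys_iff ga_space_keysD)
      then show "(\<Sum>(x, y)\<in>#ga_comult (ga_mult G h k). \<beta> x y) =
        (\<Sum>(x, y)\<in>#(\<Sum>(h1, h2)\<in>#ga_comult h.
          {#(ga_mult G h1 k1, ga_mult G h2 k2). (k1, k2) \<in># ga_comult k#}). \<beta> x y)"
        unfolding B_comult[OF mult_closed[OF hk]]
        by (simp add: sum_mset_of_sum sum_ga_comult image_mset.compositionality o_def case_prod_unfold)
    qed
  qed
qed


section \<open>Trilinear forms on a group algebra\<close>

definition ga_form3 ::
    "('g \<Rightarrow> 'g \<Rightarrow> 'g \<Rightarrow> 'k::field) \<Rightarrow> ('g \<Rightarrow>\<^sub>0 'k) \<Rightarrow> ('g \<Rightarrow>\<^sub>0 'k) \<Rightarrow> ('g \<Rightarrow>\<^sub>0 'k) \<Rightarrow> 'k"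
  where "ga_form3 \<phi> f f' f'' =
    (\<Sum>x\<in>Poly_Mapping.keys f. \<Sum>y\<in>Poly_Mapping.keys f'. \<Sum>z\<in>Poly_Mapping.keys f''.
      Poly_Mapping.lookup f x * Poly_Mapping.lookup f' y * Poly_Mapping.lookup f'' z * \<phi> x y z)"

lemma ga_form3_single [simp]:
  "ga_form3 \<phi> (Poly_Mapping.single x a) (Poly_Mapping.single y b) (Poly_Mapping.single z d) = a * b * d * \<phi> x y z"
  by (simp add: ga_form3_def)

lemma trilinear_form_on_ga_form3: "trilinear_form_on ga_scale V (ga_form3 \<phi>)"
proof -
  have first: "ga_form3 \<phi> f f' f'' = (\<Sum>x\<in>Poly_Mapping.keys f. Poly_Mapping.lookup f x *
      (\<Sum>y\<in>Poly_Mapping.keys f'. \<Sum>z\<in>Poly_Mapping.keys f''.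
        Poly_Mapping.lookup f' y * Poly_Mapping.lookup f'' z * \<phi> x y z))" for f f' f''
    by (simp add: ga_form3_def sum_distrib_left mult_ac)
  have second: "ga_form3 \<phi> f f' f'' = (\<Sum>y\<in>Poly_Mapping.keys f'. Poly_Mapping.lookup f' y *
      (\<Sum>x\<in>Poly_Mapping.keys f. \<Sum>z\<in>Poly_Mapping.keys f''.
        Poly_Mapping.lookup f x * Poly_Mapping.lookup f'' z * \<phi> x y z))" for f f' f''
    unfolding ga_form3_def
    by (subst sum.swap) (simp add: sum_distrib_left mult_ac)
  have third: "ga_form3 \<phi> f f' f'' = (\<Sum>z\<in>Poly_Mapping.keys f''. Poly_Mapping.lookup f'' z *
      (\<Sum>x\<in>Poly_Mapping.keys f. \<Sum>y\<in>Poly_Mapping.keys f'.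
        Poly_Mapping.lookup f x * Poly_Mapping.lookup f' y * \<phi> x y z))" for f f' f''
  proof -
    have "ga_form3 \<phi> f f' f'' = (\<Sum>x\<in>Poly_Mapping.keys f. \<Sum>z\<in>Poly_Mapping.keys f''. \<Sum>y\<in>Poly_Mapping.keys f'.
        Poly_Mapping.lookup f x * Poly_Mapping.lookup f' y * Poly_Mapping.lookup f'' z * \<phi> x y z)"
      unfolding ga_form3_def by (rule sum.cong[OF refl], rule sum.swap)
    also have "\<dots> = (\<Sum>z\<in>Poly_Mapping.keys f''. \<Sum>x\<in>Poly_Mapping.keys f. \<Sum>y\<in>Poly_Mapping.keys f'.
        Poly_Mapping.lookup f x * Poly_Mapping.lookup f' y * Poly_Mapping.lookup f'' z * \<phi> x y z)"
      by (rule sum.swap)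
    finally show ?thesis by (simp add: sum_distrib_left mult_ac)
  qed
  have "linear_form_on ga_scale V (\<lambda>f. ga_form3 \<phi> f g h)" for g h
    unfolding first by (rule linear_form_on_linear_extension)
  moreover have "linear_form_on ga_scale V (\<lambda>f. ga_form3 \<phi> g f h)" for g h
    unfolding second by (rule linear_form_on_linear_extension)
  moreover have "linear_form_on ga_scale V (\<lambda>f. ga_form3 \<phi> g h f)" for g h
    unfolding third by (rule linear_form_on_linear_extension)
  ultimately show ?thesis
    unfolding trilinear_form_on_def by blast
qed

lemma trilinear_form_on_single:
  assumes "trilinear_form_on ga_scale (ga_space G) \<tau>" "x \<in> carrier G" "y \<in> carrier G" "z \<in> carrier G"
  shows "\<tau> (Poly_Mapping.single x a) (Poly_Mapping.single y b) (Poly_Mapping.single z d) =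
    a * b * d * \<tau> (ga_basis x) (ga_basis y) (ga_basis z)"
proof -
  have "\<tau> (Poly_Mapping.single x a) (Poly_Mapping.single y b) (Poly_Mapping.single z d) =
      a * \<tau> (ga_basis x) (Poly_Mapping.single y b) (Poly_Mapping.single z d)"
    using assms by (intro linear_form_on_single[where F = "\<lambda>f. \<tau> f _ _"]) (auto simp: trilinear_form_on_def)
  also have "\<tau> (ga_basis x) (Poly_Mapping.single y b) (Poly_Mapping.single z d) =
      b * \<tau> (ga_basis x) (ga_basis y) (Poly_Mapping.single z d)"
    using assms by (intro linear_form_on_single[where F = "\<lambda>f. \<tau> _ f _"]) (auto simp: trilinear_form_on_def)
  also have "\<tau> (ga_basis x) (ga_basis y) (Poly_Mapping.single z d) =
      d * \<tau> (ga_basis x) (ga_basis y) (ga_basis z)"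
    using assms by (intro linear_form_on_single[where F = "\<lambda>f. \<tau> _ _ f"]) (auto simp: trilinear_form_on_def)
  finally show ?thesis by (simp add: mult.assoc)
qed

text \<open>
  Convolution is pointwise multiplication on group elements because these are grouplike.
\<close>

lemma conv3_ga_form3:
  "conv3 ga_comult (ga_form3 \<phi>) (ga_form3 \<psi>) = ga_form3 (\<lambda>x y z. \<phi> x y z * \<psi> x y z)"
  by (intro ext, unfold conv3_def sum_ga_comult split ga_form3_single) (simp add: ga_form3_def mult_ac)

lemma ga_form3_one: "ga_form3 (\<lambda>_ _ _. 1) h k l = ga_counit h * ga_counit k * ga_counit l"
  by (simp add: ga_form3_def ga_counit_def flip: sum_distrib_left sum_distrib_right)

section \<open>Group cocycles and quasi-Yetter-Drinfeld data\<close>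

locale normalized_cocycle = monoid G for G :: "('g, 'm) monoid_scheme" (structure) +
  fixes \<phi> :: "'g \<Rightarrow> 'g \<Rightarrow> 'g \<Rightarrow> 'k::field"
  assumes \<phi>_nonzero: "\<lbrakk>x \<in> carrier G; y \<in> carrier G; u \<in> carrier G\<rbrakk> \<Longrightarrow> \<phi> x y u \<noteq> 0"
    and \<phi>_normalized: "\<lbrakk>x \<in> carrier G; y \<in> carrier G\<rbrakk> \<Longrightarrow> \<phi> x \<one> y = 1"
    and \<phi>_cocycle: "\<lbrakk>x \<in> carrier G; y \<in> carrier G; u \<in> carrier G; v \<in> carrier G\<rbrakk> \<Longrightarrow>
      \<phi> y u v * \<phi> x (y \<otimes> u) v * \<phi> x y u = \<phi> x y (u \<otimes> v) * \<phi> (x \<otimes> y) u v"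
begin

lemma is_conv_inverse_ga_form3:
  "is_conv_inverse ga_scale (ga_space G) ga_comult ga_counit (ga_form3 \<phi>) (ga_form3 (\<lambda>x y u. inverse (\<phi> x y u)))"
proof -
  have "ga_form3 (\<lambda>x y u. \<phi> x y u * inverse (\<phi> x y u)) h k l = ga_form3 (\<lambda>_ _ _. 1) h k l"
    if "h \<in> ga_space G" "k \<in> ga_space G" "l \<in> ga_space G" for h k l
    using that unfolding ga_form3_def
    by (intro sum.cong refl) (simp add: \<phi>_nonzero ga_space_keysD)
  then show ?thesis
    by (simp add: is_conv_inverse_def trilinear_form_on_ga_form3 conv3_ga_form3 ga_form3_one
        mult.commute[of "inverse _"])
qed

text \<open>
  Since \<open>G\<close> is associative, quasi-associativity holds for every \<open>\<phi>\<close>: both of its sides weight the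
  same product \<open>xyu\<close> by \<open>\<phi> x y u\<close>.
\<close>

sublocale ga: dual_quasi_bialgebra ga_scale "ga_space G" ga_comult ga_counit "ga_mult G" "ga_unit G"
  "ga_form3 \<phi>"
proof -
  interpret coalgebra_with_mult_unit ga_scale "ga_space G :: ('g \<Rightarrow>\<^sub>0 'k) set" ga_comult ga_counit
      "ga_mult G" "ga_unit G"
    by (rule coalgebra_with_mult_unit_group_algebra) (rule monoid_axioms)
  show "dual_quasi_bialgebra ga_scale (ga_space G) ga_comult ga_counit (ga_mult G) (ga_unit G) (ga_form3 \<phi>)"
  proof
    show "trilinear_form_on ga_scale (ga_space G) (ga_form3 \<phi>)" by (rule trilinear_form_on_ga_form3)
    show "\<exists>\<omega>'. is_conv_inverse ga_scale (ga_space G) ga_comult ga_counit (ga_form3 \<phi>) \<omega>'"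
      using is_conv_inverse_ga_form3 by blast
  next
    fix h k l r :: "'g \<Rightarrow>\<^sub>0 'k"
    assume "h \<in> ga_space G" "k \<in> ga_space G" "l \<in> ga_space G" "r \<in> ga_space G"
    then show "conv4 ga_comult (conv4 ga_comult (\<lambda>h k l r. ga_counit h * ga_form3 \<phi> k l r)
          (\<lambda>h k l r. ga_form3 \<phi> h (ga_mult G k l) r)) (\<lambda>h k l r. ga_form3 \<phi> h k l * ga_counit r) h k l r =
        conv4 ga_comult (\<lambda>h k l r. ga_form3 \<phi> h k (ga_mult G l r))
          (\<lambda>h k l r. ga_form3 \<phi> (ga_mult G h k) l r) h k l r"
      unfolding conv4_def sum_ga_comult split
      by (intro sum.cong refl)
         (simp add: ga_comult_single in_keys_iff ga_space_keysD \<phi>_cocycle[symmetric] mult_ac)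
  next
    fix h h' :: "'g \<Rightarrow>\<^sub>0 'k" assume "h \<in> ga_space G" "h' \<in> ga_space G"
    then show "ga_form3 \<phi> h (ga_unit G) h' = ga_counit h * ga_counit h'"
      by (simp add: ga_form3_def ga_unit_def ga_elem_def \<phi>_normalized ga_space_keysD ga_counit_def sum_product
          cong: sum.cong_simp)
  next
    fix h k l :: "'g \<Rightarrow>\<^sub>0 'k" assume "h \<in> ga_space G" "k \<in> ga_space G" "l \<in> ga_space G"
    then show "(\<Sum>(h1, h2)\<in>#ga_comult h. \<Sum>(k1, k2)\<in>#ga_comult k. \<Sum>(l1, l2)\<in>#ga_comult l.
          ga_scale (ga_form3 \<phi> h2 k2 l2) (ga_mult G h1 (ga_mult G k1 l1))) =
        (\<Sum>(h1, h2)\<in>#ga_comult h. \<Sum>(k1, k2)\<in>#ga_comult k. \<Sum>(l1, l2)\<in>#ga_comult l.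
          ga_scale (ga_form3 \<phi> h1 k1 l1) (ga_mult G (ga_mult G h2 k2) l2))"
      unfolding sum_ga_comult split
      by (intro sum.cong refl) (simp add: ga_space_keysD m_assoc mult_ac)
  next
    fix h :: "'g \<Rightarrow>\<^sub>0 'k" assume h: "h \<in> ga_space G"
    show "ga_mult G (ga_unit G) h = h"
      using h by (simp add: ga_mult_expand ga_unit_def ga_elem_def ga_space_keysD cong: sum.cong_simp flip: ga_expansion)
    show "ga_mult G h (ga_unit G) = h"
      using h by (simp add: ga_mult_expand ga_unit_def ga_elem_def ga_space_keysD cong: sum.cong_simp flip: ga_expansion)
  qed
qed

text \<open>
  The chosen inverse is only specified up to its defining equation; evaluated on three grouplike
  elements that equation forces the value \<open>1 / \<phi> x y u\<close>.
\<close>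

lemma \<omega>_inv_single:
  assumes "x \<in> carrier G" "y \<in> carrier G" "u \<in> carrier G"
  shows "ga.\<omega>_inv (Poly_Mapping.single x a) (Poly_Mapping.single y b) (Poly_Mapping.single u d) =
    a * b * d * inverse (\<phi> x y u)"
proof -
  have inv: "is_conv_inverse ga_scale (ga_space G) ga_comult ga_counit (ga_form3 \<phi>) ga.\<omega>_inv"
    unfolding ga.\<omega>_inv_def using ga.\<omega>_invertible by (rule someI_ex)
  then have "conv3 ga_comult (ga_form3 \<phi>) ga.\<omega>_inv (ga_basis x) (ga_basis y) (ga_basis u) = 1"
    using assms by (simp add: is_conv_inverse_def)
  then have "\<phi> x y u * ga.\<omega>_inv (ga_basis x) (ga_basis y) (ga_basis u) = 1"
    by (simp add: conv3_def ga_comult_single)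
  then have "ga.\<omega>_inv (ga_basis x) (ga_basis y) (ga_basis u) = inverse (\<phi> x y u)"
    by (metis inverse_unique)
  then show ?thesis
    using inv assms trilinear_form_on_single[of G ga.\<omega>_inv x y u a b d] by (simp add: is_conv_inverse_def)
qed

text \<open>
  Both sides of each defining equation are expanded on the basis.  The equation for
  \<open>g\<close> and \<open>\<chi>\<close> compares \<open>\<chi> x\<close> times \<open>gx\<close> with \<open>\<chi> x\<close> times \<open>xg\<close>, which constrains \<open>x\<close> only
  if \<open>\<chi> x \<noteq> 0\<close>.
\<close>

lemma quasi_YD_datum_iff:
  assumes g: "g \<in> carrier G" and \<chi>: "linear_form_on ga_scale (ga_space G) \<chi>"
  shows "quasi_YD_datum ga_scale (ga_space G) ga_comult ga_counit (ga_mult G) (ga_unit G) (ga_form3 \<phi>) (ga_elem g) \<chi>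
    \<longleftrightarrow> \<chi> (ga_elem \<one>) = 1 \<and>
      (\<forall>x\<in>carrier G. \<forall>y\<in>carrier G. \<chi> (ga_elem (x \<otimes> y)) =
        inverse (\<phi> x y g) * \<phi> x g y * inverse (\<phi> g x y) * \<chi> (ga_elem x) * \<chi> (ga_elem y)) \<and>
      (\<forall>x\<in>carrier G. \<chi> (ga_elem x) \<noteq> 0 \<longrightarrow> g \<otimes> x = x \<otimes> g)"
    (is "?YD \<longleftrightarrow> ?unit \<and> ?mult \<and> ?comm")
proof -
  note \<chi>_single = linear_form_on_single[OF \<chi>]
  let ?rhs = "\<lambda>h l. \<Sum>(h1, h2, h3, h4)\<in>#sweedler4 ga_comult h. \<Sum>(l1, l2, l3, l4)\<in>#sweedler4 ga_comult l.
        ga.\<omega>_inv h1 l1 (ga_elem g) * \<chi> l2 * ga_form3 \<phi> h2 (ga_elem g) l3 * \<chi> h3 * ga.\<omega>_inv (ga_elem g) h4 l4"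
  have rhs: "?rhs h l = (\<Sum>x\<in>Poly_Mapping.keys h. \<Sum>y\<in>Poly_Mapping.keys l.
      Poly_Mapping.lookup h x * Poly_Mapping.lookup l y *
      (inverse (\<phi> x y g) * \<phi> x g y * inverse (\<phi> g x y) * \<chi> (ga_elem x) * \<chi> (ga_elem y)))"
    if "h \<in> ga_space G" "l \<in> ga_space G" for h l
    unfolding sum_sweedler4 split ga_elem_def using that g
    by (intro sum.cong refl) (simp add: \<omega>_inv_single ga_space_keysD mult_ac)
  have lhs: "\<chi> (ga_mult G h l) = (\<Sum>x\<in>Poly_Mapping.keys h. \<Sum>y\<in>Poly_Mapping.keys l.
      Poly_Mapping.lookup h x * Poly_Mapping.lookup l y * \<chi> (ga_elem (x \<otimes> y)))"
    if "h \<in> ga_space G" "l \<in> ga_space G" for h l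
    unfolding linear_form_on_ga_mult[OF monoid_axioms \<chi> that] ga_elem_def using that
    by (intro sum.cong refl) (simp add: \<chi>_single[where a = "_ * _"] \<chi>_single[where a = "Poly_Mapping.lookup _ _"] ga_space_keysD)
  have left: "(\<Sum>(h1, h2)\<in>#ga_comult h. ga_scale (\<chi> h1) (ga_mult G (ga_elem g) h2)) =
      (\<Sum>x\<in>Poly_Mapping.keys h. Poly_Mapping.single (g \<otimes> x) (Poly_Mapping.lookup h x * \<chi> (ga_elem x)))"
    if "h \<in> ga_space G" for h
    unfolding sum_ga_comult split ga_elem_def using that
    by (intro sum.cong refl) (simp add: \<chi>_single[where a = "_ * _"] \<chi>_single[where a = "Poly_Mapping.lookup _ _"] ga_space_keysD)
  have right: "(\<Sum>(h1, h2)\<in>#ga_comult h. ga_scale (\<chi> h2) (ga_mult G h1 (ga_elem g))) =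
      (\<Sum>x\<in>Poly_Mapping.keys h. Poly_Mapping.single (x \<otimes> g) (Poly_Mapping.lookup h x * \<chi> (ga_elem x)))"
    for h
    unfolding sum_ga_comult split ga_elem_def
    by (intro sum.cong refl) (simp add: mult_ac)
  show ?thesis
  proof (intro iffI conjI ballI impI)
    assume ?YD
    then interpret YD: quasi_YD_datum ga_scale "ga_space G" ga_comult ga_counit "ga_mult G" "ga_unit G"
      "ga_form3 \<phi>" "ga_elem g" \<chi> .
    show ?unit using YD.\<chi>_unit by (simp add: ga_unit_def)
    fix x assume x: "x \<in> carrier G"
    {
      fix y assume y: "y \<in> carrier G"
      have "\<chi> (ga_mult G (ga_basis x) (ga_basis y)) = ?rhs (ga_basis x) (ga_basis y)"
        using x y by (intro YD.\<chi>_mult) auto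
      then show "\<chi> (ga_elem (x \<otimes> y)) =
        inverse (\<phi> x y g) * \<phi> x g y * inverse (\<phi> g x y) * \<chi> (ga_elem x) * \<chi> (ga_elem y)"
        by (subst (asm) rhs) (use x y in \<open>simp_all add: ga_elem_def\<close>)
    }
    assume "\<chi> (ga_elem x) \<noteq> 0"
    have "(\<Sum>(h1, h2)\<in>#ga_comult (ga_basis x). ga_scale (\<chi> h1) (ga_mult G (ga_elem g) h2)) =
        (\<Sum>(h1, h2)\<in>#ga_comult (ga_basis x). ga_scale (\<chi> h2) (ga_mult G h1 (ga_elem g)))"
      using x by (intro YD.g_\<chi>_commute) simp
    then have "Poly_Mapping.single (g \<otimes> x) (\<chi> (ga_elem x)) = Poly_Mapping.single (x \<otimes> g) (\<chi> (ga_elem x))"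
      by (subst (asm) left) (use x right in simp_all)
    then have "Poly_Mapping.keys (Poly_Mapping.single (g \<otimes> x) (\<chi> (ga_elem x))) =
        Poly_Mapping.keys (Poly_Mapping.single (x \<otimes> g) (\<chi> (ga_elem x)))"
      by simp
    then show "g \<otimes> x = x \<otimes> g"
      using \<open>\<chi> (ga_elem x) \<noteq> 0\<close> by simp
  next
    assume *: "?unit \<and> ?mult \<and> ?comm"
    show ?YD
    proof
      show "ga_elem g \<in> ga.grouplikes"
        using g by (simp add: ga.grouplikes_def ga_elem_def tensor2_eq_def ga_comult_single)
      show "linear_form_on ga_scale (ga_space G) \<chi>" by (rule \<chi>)
      show "\<chi> (ga_unit G) = 1" using * by (simp add: ga_unit_def)
    next
      fix h l :: "'g \<Rightarrow>\<^sub>0 'k" assume hl: "h \<in> ga_space G" "l \<in> ga_space G"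
      show "\<chi> (ga_mult G h l) = ?rhs h l"
        unfolding lhs[OF hl] rhs[OF hl] using * hl
        by (intro sum.cong refl) (simp add: ga_space_keysD)
    next
      fix h :: "'g \<Rightarrow>\<^sub>0 'k" assume h: "h \<in> ga_space G"
      show "(\<Sum>(h1, h2)\<in>#ga_comult h. ga_scale (\<chi> h1) (ga_mult G (ga_elem g) h2)) =
          (\<Sum>(h1, h2)\<in>#ga_comult h. ga_scale (\<chi> h2) (ga_mult G h1 (ga_elem g)))"
        unfolding left[OF h] right
      proof (intro sum.cong refl)
        fix x assume "x \<in> Poly_Mapping.keys h"
        then have "x \<in> carrier G" using h by (rule ga_space_keysD[rotated])
        then show "Poly_Mapping.single (g \<otimes> x) (Poly_Mapping.lookup h x * \<chi> (ga_elem x)) =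
            Poly_Mapping.single (x \<otimes> g) (Poly_Mapping.lookup h x * \<chi> (ga_elem x))"
          using * by (cases "\<chi> (ga_elem x) = 0") auto
      qed
    qed
  qed
qed

end

section \<open>The carry cocycle of a cyclic group\<close>

lemma of_bool_carry_eq_div:
  fixes i j n :: nat
  assumes "i < n" "j < n"
  shows "of_bool (i + j > n - 1) = (i + j) div n"
proof (cases "i + j < n")
  case True
  then have "\<not> i + j > n - 1" by linarith
  with True show ?thesis by simp
next
  case False
  then have "(i + j) div n = 1" "i + j > n - 1" using assms by (auto intro!: div_nat_eqI)
  then show ?thesis by simp
qed

text \<open>
  Both sides are \<open>(i + j + k) div n\<close>: adding three digits in either order produces the same total
  carry.
\<close>

lemma carry_cocycle:
  fixes i j k n :: nat
  assumes "i < n" "j < n" "k < n"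
  shows "of_bool (i + j > n - 1) + of_bool ((i + j) mod n + k > n - 1) =
    (of_bool (j + k > n - 1) + of_bool (i + (j + k) mod n > n - 1) :: nat)"
proof -
  have n: "0 < n" using assms by simp
  have split: "(x + y) div n = x div n + (x mod n + y) div n" for x y
  proof -
    have "x + y = (x mod n + y) + x div n * n" by simp
    then show ?thesis using n by (metis add.commute div_mult_self1 neq0_conv)
  qed
  have "(i + j) div n + ((i + j) mod n + k) div n = (i + j + k) div n"
    by (rule split[symmetric])
  moreover have "(j + k) div n + (i + (j + k) mod n) div n = (i + j + k) div n"
    using split[of "j + k" i] by (simp add: ac_simps)
  ultimately show ?thesis
    using assms by (simp only: of_bool_carry_eq_div mod_less_divisor[OF n])
qed

locale finite_cyclic_group = group G for G :: "('g, 'm) monoid_scheme" (structure) +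
  fixes c :: 'g and n :: nat
  assumes generator: "c \<in> carrier G" "carrier G = generate G {c}"
    and card: "card (carrier G) = n" "n > 0"
begin

lemma cyc_exp_generator_pow [simp]: "cyc_exp G c (c [^] (a::nat)) = a mod n"
  using cyc_exp_pow[OF generator] card card_ge_0_finite by auto

lemma pow_mod [simp]: "c [^] (a mod n) = c [^] (a::nat)"
  using pow_mod_card[OF generator(1)] card card_ge_0_finite by auto

lemma carrier_powE:
  assumes "x \<in> carrier G"
  obtains a :: nat where "a < n" "x = c [^] a"
proof -
  from assms obtain k :: int where "x = c [^] k"
    using generator generate_pow[OF generator(1)] by auto
  also have "c [^] k = c [^] (int n * (k div int n) + k mod int n)" by simp
  also have "\<dots> = (c [^] int n) [^] (k div int n) \<otimes> c [^] (k mod int n)"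
    using generator(1) by (simp only: int_pow_mult int_pow_pow)
  also have "c [^] int n = \<one>"
    using pow_order_eq_1[OF generator(1)] card by (simp add: int_pow_int Coset.order_def)
  also have "\<one> [^] (k div int n) \<otimes> c [^] (k mod int n) = c [^] int (nat (k mod int n))"
    using generator(1) card by simp
  finally have "x = c [^] nat (k mod int n)" by (simp only: int_pow_int)
  moreover have "nat (k mod int n) < n" using card by (simp add: nat_less_iff)
  ultimately show thesis using that by blast
qed

text \<open>
  Besides \<open>carry_cocycle\<close>, this needs \<open>\<xi>\<^sup>n = 1\<close>: the factor \<open>\<phi> (x \<otimes> y) u v\<close> contains the exponent of
  \<open>x \<otimes> y\<close> reduced modulo \<open>n\<close>, whereas the other side yields the unreduced sum.
\<close>

lemma normalized_cocycle_carry: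
  fixes \<xi> :: "'k::field"
  assumes \<xi>: "\<xi> ^ n = 1"
  shows "normalized_cocycle G
    (\<lambda>x y u. \<xi> ^ (cyc_exp G c x * of_bool (cyc_exp G c y + cyc_exp G c u > card (carrier G) - 1)))"
proof
  have \<xi>_nonzero: "\<xi> \<noteq> 0" using \<xi> card by (auto simp: power_0_left)
  have \<xi>_mod: "\<xi> ^ (a mod n * m) = \<xi> ^ (a * m)" for a m :: nat
  proof -
    have "\<xi> ^ (a * m) = \<xi> ^ (n * (a div n * m) + a mod n * m)"
      by (metis add_mult_distrib mult.assoc mult_div_mod_eq)
    then show ?thesis using \<xi> by (simp add: power_add power_mult)
  qed
  fix x y assume x: "x \<in> carrier G" and y: "y \<in> carrier G"
  obtain a b where ab: "a < n" "x = c [^] a" "b < n" "y = c [^] b"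
    using x y carrier_powE by metis
  show "\<xi> ^ (cyc_exp G c x * of_bool (cyc_exp G c \<one> + cyc_exp G c y > card (carrier G) - 1)) = 1"
    using cyc_exp_generator_pow[of 0] ab card by simp
  fix u assume u: "u \<in> carrier G"
  show "\<xi> ^ (cyc_exp G c x * of_bool (cyc_exp G c y + cyc_exp G c u > card (carrier G) - 1)) \<noteq> 0"
    using \<xi>_nonzero by simp
  fix v assume v: "v \<in> carrier G"
  obtain d e where de: "d < n" "u = c [^] d" "e < n" "v = c [^] e"
    using u v carrier_powE by metis
  have eq: "a * of_bool ((b + d) mod n + e > n - 1) + a * of_bool (b + d > n - 1) =
      (a * of_bool (d + e > n - 1) + a * of_bool (b + (d + e) mod n > n - 1) :: nat)"
    using carry_cocycle[of b n d e] ab de unfolding distrib_left[symmetric] by simp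
  show "\<xi> ^ (cyc_exp G c y * of_bool (cyc_exp G c u + cyc_exp G c v > card (carrier G) - 1)) *
      \<xi> ^ (cyc_exp G c x * of_bool (cyc_exp G c (y \<otimes> u) + cyc_exp G c v > card (carrier G) - 1)) *
      \<xi> ^ (cyc_exp G c x * of_bool (cyc_exp G c y + cyc_exp G c u > card (carrier G) - 1)) =
      \<xi> ^ (cyc_exp G c x * of_bool (cyc_exp G c y + cyc_exp G c (u \<otimes> v) > card (carrier G) - 1)) *
      \<xi> ^ (cyc_exp G c (x \<otimes> y) * of_bool (cyc_exp G c u + cyc_exp G c v > card (carrier G) - 1))"
  proof -
    have "\<xi> ^ (b * of_bool (d + e > n - 1)) * \<xi> ^ (a * of_bool ((b + d) mod n + e > n - 1)) *
        \<xi> ^ (a * of_bool (b + d > n - 1)) =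
        \<xi> ^ (b * of_bool (d + e > n - 1)) * \<xi> ^ (a * of_bool (d + e > n - 1) + a * of_bool (b + (d + e) mod n > n - 1))"
      by (simp only: eq[symmetric] power_add mult.assoc)
    also have "\<dots> = \<xi> ^ (a * of_bool (b + (d + e) mod n > n - 1)) * \<xi> ^ ((a + b) * of_bool (d + e > n - 1))"
      by (simp only: power_add distrib_right mult_ac)
    also have "\<xi> ^ ((a + b) * of_bool (d + e > n - 1)) = (\<xi> ^ ((a + b) mod n * of_bool (d + e > n - 1)) :: 'k)"
      by (simp only: \<xi>_mod)
    finally show ?thesis
      using ab de card generator(1) by (simp add: nat_pow_mult del: of_bool_eq)
  qed
qed

lemma quasi_YD_datum_cyc_omega_iff:
  fixes \<xi> :: "'k::field"
  assumes \<xi>: "\<xi> ^ n = 1" and z: "z < n" and \<chi>: "linear_form_on ga_scale (ga_space G) \<chi>"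
  shows "quasi_YD_datum ga_scale (ga_space G) ga_comult ga_counit (ga_mult G) (ga_unit G)
      (cyc_omega G c \<xi>) (ga_elem (c [^] z)) \<chi> \<longleftrightarrow>
    \<chi> (ga_elem \<one>) = 1 \<and>
    (\<forall>a<n. \<forall>b<n. \<chi> (ga_elem (c [^] (a + b))) * \<xi> ^ (z * of_bool (a + b \<ge> n)) =
      \<chi> (ga_elem (c [^] a)) * \<chi> (ga_elem (c [^] b)))"
proof -
  have \<xi>_nonzero: "\<xi> \<noteq> 0" using \<xi> card by (auto simp: power_0_left)
  define \<phi> where "\<phi> = (\<lambda>x y u. \<xi> ^ (cyc_exp G c x * of_bool (cyc_exp G c y + cyc_exp G c u > card (carrier G) - 1)))"
  interpret normalized_cocycle G \<phi>
    unfolding \<phi>_def using \<xi> by (rule normalized_cocycle_carry)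
  have omega: "cyc_omega G c \<xi> = ga_form3 \<phi>"
    by (intro ext) (simp add: cyc_omega_def ga_form3_def \<phi>_def)
  have gt: "i > n - Suc 0 \<longleftrightarrow> i \<ge> n" for i using card by auto
  have comm: "x \<otimes> y = y \<otimes> x" if "x \<in> carrier G" "y \<in> carrier G" for x y
    using carrier_powE[OF that(1)] carrier_powE[OF that(2)] generator(1) nat_pow_mult
    by (metis add.commute)
  \<comment> \<open>This symmetry cancels the two factors of the multiplicativity condition with \<open>g\<close> in second or third place.\<close>
  have \<phi>_sym: "\<phi> x y u = \<phi> x u y" for x y u
    by (simp add: \<phi>_def add.commute)
  have all_pow: "(\<forall>x\<in>carrier G. P x) \<longleftrightarrow> (\<forall>a<n. P (c [^] a))" for P
    using generator(1) by (metis carrier_powE nat_pow_closed)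
  have gz: "c [^] z \<in> carrier G" using generator(1) by simp
  have eq: "\<chi> (ga_elem (c [^] a \<otimes> c [^] b)) =
        inverse (\<phi> (c [^] a) (c [^] b) (c [^] z)) * \<phi> (c [^] a) (c [^] z) (c [^] b) *
        inverse (\<phi> (c [^] z) (c [^] a) (c [^] b)) * \<chi> (ga_elem (c [^] a)) * \<chi> (ga_elem (c [^] b)) \<longleftrightarrow>
      \<chi> (ga_elem (c [^] (a + b))) * \<xi> ^ (z * of_bool (a + b \<ge> n)) =
        \<chi> (ga_elem (c [^] a)) * \<chi> (ga_elem (c [^] b))" if "a < n" "b < n" for a b
  proof -
    have "\<phi> (c [^] a) (c [^] b) (c [^] z) \<noteq> 0" using generator(1) by (simp add: \<phi>_nonzero)
    moreover have "\<phi> (c [^] a) (c [^] z) (c [^] b) = \<phi> (c [^] a) (c [^] b) (c [^] z)" by (rule \<phi>_sym)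
    moreover have "\<phi> (c [^] z) (c [^] a) (c [^] b) = \<xi> ^ (z * of_bool (a + b \<ge> n))"
      using that z by (simp add: \<phi>_def card(1) gt)
    ultimately show ?thesis
      using generator(1) \<xi>_nonzero by (simp add: nat_pow_mult field_simps)
  qed
  show ?thesis
    unfolding omega quasi_YD_datum_iff[OF gz \<chi>] all_pow
    using comm gz generator(1) by (simp add: eq cong: conj_cong)
qed

end

theorem proposition6p4:
  fixes G :: "('g, 'm) monoid_scheme" and c :: 'g
    and q \<zeta> :: "'k::{alg_closed_field, field_char_0}"
    and n w z :: nat
    and \<chi> :: "('g \<Rightarrow>\<^sub>0 'k) \<Rightarrow> 'k"
  assumes n: "n > 1"
    and q: "primitive_root_of_unity (n ^ 2) q"
    and \<zeta>: "\<zeta> = q ^ n"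
    and G: "group G" "c \<in> carrier G" "carrier G = generate G {c}" "card (carrier G) = n"
    and w: "w \<le> n - 1"
    and z: "z \<le> n - 1"
    and \<chi>: "linear_form_on ga_scale (ga_space G) \<chi>"
  shows "(quasi_YD_datum ga_scale (ga_space G) ga_comult ga_counit (ga_mult G) (ga_unit G)
              (cyc_omega G c (\<zeta> ^ w)) (ga_elem (c [^]\<^bsub>G\<^esub> z)) \<chi>
          \<longrightarrow>
            (\<forall>t\<le>n - 1. \<chi> (ga_elem (c [^]\<^bsub>G\<^esub> t)) = \<chi> (ga_elem c) ^ t) \<and>
            \<chi> (ga_elem c) ^ n = \<zeta> ^ (w * z)) \<and>
         (((\<forall>t\<le>n - 1. \<chi> (ga_elem (c [^]\<^bsub>G\<^esub> t)) = \<chi> (ga_elem c) ^ t) \<and>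
            \<chi> (ga_elem c) ^ n = \<zeta> ^ (w * z))
          \<longleftrightarrow>
            (\<forall>t::nat. \<chi> (ga_elem (c [^]\<^bsub>G\<^esub> t)) = \<chi> (ga_elem c) ^ (t mod n)) \<and>
            \<chi> (ga_elem c) ^ n = \<zeta> ^ (w * z)) \<and>
         (\<chi> (ga_unit G) = 1 \<and>
            (\<forall>t\<le>n - 1. \<chi> (ga_elem (c [^]\<^bsub>G\<^esub> t)) = \<chi> (ga_elem c) ^ t) \<and>
            \<chi> (ga_elem c) ^ n = \<zeta> ^ (w * z)
          \<longrightarrow>
            quasi_YD_datum ga_scale (ga_space G) ga_comult ga_counit (ga_mult G) (ga_unit G)
              (cyc_omega G c (\<zeta> ^ w)) (ga_elem (c [^]\<^bsub>G\<^esub> z)) \<chi>)"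
proof -
  define \<xi> where "\<xi> = \<zeta> ^ w"
  have fin: "n > 0" using n by simp
  interpret finite_cyclic_group G c n
    using G fin by (simp add: finite_cyclic_group_def finite_cyclic_group_axioms_def)
  have "\<zeta> ^ n = 1"
    using q \<zeta> by (simp add: primitive_root_of_unity_def power2_eq_square power_mult)
  then have \<xi>n: "\<xi> ^ n = 1"
    unfolding \<xi>_def by (metis mult.commute power_mult power_one)
  have \<xi>z: "\<xi> ^ z = \<zeta> ^ (w * z)"
    by (simp add: \<xi>_def power_mult)
  have z_less: "z < n" using z n by simp
  have le: "t \<le> n - 1 \<longleftrightarrow> t < n" for t using n by auto
  let ?f = "\<lambda>t::nat. \<chi> (ga_elem (c [^]\<^bsub>G\<^esub> t))"
  let ?YD = "quasi_YD_datum ga_scale (ga_space G) ga_comult ga_counit (ga_mult G) (ga_unit G)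
              (cyc_omega G c \<xi>) (ga_elem (c [^]\<^bsub>G\<^esub> z)) \<chi>"
  let ?star = "(\<forall>t<n. ?f t = \<chi> (ga_elem c) ^ t) \<and> \<chi> (ga_elem c) ^ n = \<xi> ^ z"
  note YD_iff = quasi_YD_datum_cyc_omega_iff[OF \<xi>n z_less \<chi>]
  have f1: "?f 1 = \<chi> (ga_elem c)" using G(2) by simp
  have f_mod: "?f (t mod n) = ?f t" for t by simp
  have forward: ?star if ?YD
  proof -
    from that have f0: "?f 0 = 1"
      and mult: "\<And>a b. a < n \<Longrightarrow> b < n \<Longrightarrow> ?f (a + b) * \<xi> ^ (z * of_bool (a + b \<ge> n)) = ?f a * ?f b"
      unfolding YD_iff by auto
    have pow: "?f t = \<chi> (ga_elem c) ^ t" if "t < n" for t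
      using that
    proof (induction t)
      case 0
      show ?case using f0 by simp
    next
      case (Suc t)
      then show ?case using mult[of t 1] f1 n by (simp del: nat_pow_Suc)
    qed
    \<comment> \<open>Multiplying \<open>c\<^sup>n\<^sup>-\<^sup>1\<close> by \<open>c\<close> is the first product with a carry, and it returns to the unit.\<close>
    have "?f n = 1" using f_mod[of n] f0 by simp
    then have "\<xi> ^ z = ?f (n - 1) * ?f 1" using mult[of "n - 1" 1] n by simp
    also have "\<dots> = \<chi> (ga_elem c) ^ n"
      using pow[of "n - 1"] f1 n by (simp flip: power_Suc2)
    finally show ?thesis using pow by simp
  qed
  have backward: ?YD if unit: "\<chi> (ga_unit G) = 1" and ?star
    unfolding YD_iff
  proof (intro conjI allI impI)
    show "\<chi> (ga_elem \<one>\<^bsub>G\<^esub>) = 1" using unit by (simp add: ga_unit_def)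
    fix a b assume ab: "a < n" "b < n"
    have pow: "?f t = \<chi> (ga_elem c) ^ (t mod n)" for t
      using \<open>?star\<close> f_mod[of t] fin by (metis mod_less_divisor)
    show "?f (a + b) * \<xi> ^ (z * of_bool (a + b \<ge> n)) = ?f a * ?f b"
    proof (cases "a + b < n")
      case True
      then show ?thesis using ab by (simp only: pow) (simp add: power_add)
    next
      case False
      then have mod: "(a + b) mod n = a + b - n" using ab by (simp add: mod_if)
      have "?f (a + b) * \<xi> ^ z = \<chi> (ga_elem c) ^ (a + b - n + n)"
        using \<open>?star\<close> by (simp only: pow mod power_add)
      also have "\<dots> = ?f a * ?f b" using ab False by (simp only: pow) (simp add: power_add)
      finally show ?thesis using False by simp
    qed
  qed
  have reduced: "(\<forall>t<n. ?f t = \<chi> (ga_elem c) ^ t) \<longleftrightarrow> (\<forall>t. ?f t = \<chi> (ga_elem c) ^ (t mod n))"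
    using f_mod fin by (metis mod_less mod_less_divisor)
  show ?thesis
    unfolding le \<xi>_def[symmetric] \<xi>z[symmetric] using forward backward reduced by blast
qed

end
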